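(* Let $\Gamma:\ell_\infty^+\to\ell_\infty^+$ be a well-defined and continuous gain operator. The augmented gain operator $\hat\Gamma(s):=s\oplus\Gamma(s)$ has the following properties: (i) $\hat\Gamma$ is well-defined (as a map $\ell_\infty^+\to\ell_\infty^+$) and continuous. (ii) $\hat\Gamma(0)=0$ and $\hat\Gamma$ is a monotone operator. (iii) $\hat\Gamma(s)\ge s$ for all $s\in\ell_\infty^+$. (iv) $\hat\Gamma(s)=s$ if and only if $\Gamma(s)\le s$. That is, the fixed points of $\hat\Gamma$ are precisely the points of decay for $\Gamma$. (v) $\bigoplus_{i=0}^n\Gamma^i(s)\le\hat\Gamma^n(s)$ for all $n\ge0$ and $s\in\ell_\infty^+$. (vi) $\hat\Gamma^n(s)=s\oplus\Gamma(\hat\Gamma^{n-1}(s))$ for all $n\ge1$ and $s\in\ell_\infty^+$.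
   Context: $\mathbb{N}=\{1,2,\dots\}$, $\mathbb{R}_+=[0,\infty)$. $\ell_\infty$ is the Banach space of bounded real sequences with sup norm $\|\cdot\|_\infty$; $\ell_\infty^+$ is the cone of nonnegative sequences; $\le$ is the componentwise order; $\oplus$, $\bigoplus$ denote the componentwise maximum. For $I\subseteq\mathbb{N}$, $\ell_\infty^+(I)=\{s\in\ell_\infty^+: s_i=0\ \forall i\notin I\}$. An operator $T:\ell_\infty^+\to\ell_\infty^+$ is monotone if $s^1\le s^2\Rightarrow T(s^1)\le T(s^2)$. $\mathcal{K}$: continuous strictly increasing $\gamma:\mathbb{R}_+\to\mathbb{R}_+$ with $\gamma(0)=0$. A monotone aggregation function (MAF) is $\mu:\ell_\infty^+\to[0,\infty]$ with $\mu(0)=0$; $s^1\le s^2\Rightarrow\mu(s^1)\le\mu(s^2)$; and $\mu$ finite-valued and continuous on $\ell_\infty^+(I)$ for every finite $I\subset\mathbb{N}$. Gain operator: for each $i\in\mathbb{N}$ one is given a finite set $I_i\subset\mathbb{N}\setminus\{i\}$, functions $\gamma_{ij}\in\mathcal{K}\cup\{0\}$ ($j\in\mathbb{N}$) with $\gamma_{ij}=0$ for $j\notin I_i$, and a MAF $\mu_i$; $\Gamma(s)=(\mu_i([\gamma_{ij}(s_j)]_{j\in\mathbb{N}}))_{i\in\mathbb{N}}$. "Well-defined and continuous": $\Gamma$ maps $\ell_\infty^+$ into itself and is norm-continuous. A point of decay for $\Gamma$ is an $s\in\ell_\infty^+\setminus\{0\}$ with $\Gamma(s)\le s$ (the second sentence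 of (iv) is understood for non-zero points). *)

theory Defs
  imports "HOL-Analysis.Analysis"
begin

text \<open>
  Sequences are functions on \<^typ>\<open>nat\<close>: the index set is the countable set of naturals starting at 0
  instead of 1. The order \<open>\<le>\<close> and the operation \<open>sup\<close> on \<^typ>\<open>nat \<Rightarrow> real\<close> are componentwise,
  so \<open>sup\<close> is the componentwise maximum. The topology that the library puts on \<^typ>\<open>nat \<Rightarrow> real\<close> is the
  product topology, so norm-continuity is expressed through \<open>linf_metric\<close> instead.
\<close>

definition linf_metric :: "(nat \<Rightarrow> real) metric" where
  "linf_metric = funspace UNIV euclidean_metric"

lemma mspace_linf_metric: "mspace linf_metric = {s. bounded (range s)}"
  by (auto simp: linf_metric_def Met_TC.fspace_def Met_TC.mbounded_def bounded_def)

lemma mdist_linf_metric: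
  assumes "bounded (range s)" "bounded (range t)"
  shows "mdist linf_metric s t = (SUP i. \<bar>s i - t i\<bar>)"
proof -
  have "s \<in> Met_TC.fspace UNIV" "t \<in> Met_TC.fspace UNIV"
    using assms mspace_linf_metric by (auto simp: linf_metric_def)
  then show ?thesis
    by (simp add: linf_metric_def Met_TC.fdist_def dist_real_def)
qed

definition linf_pos :: "(nat \<Rightarrow> real) set" where
  "linf_pos = {s \<in> mspace linf_metric. \<forall>i. 0 \<le> s i}"

definition linf_pos_on :: "nat set \<Rightarrow> (nat \<Rightarrow> real) set" where
  "linf_pos_on I = {s \<in> linf_pos. \<forall>i. i \<notin> I \<longrightarrow> s i = 0}"

definition norm_continuous_on ::
  "(nat \<Rightarrow> real) set \<Rightarrow> ((nat \<Rightarrow> real) \<Rightarrow> (nat \<Rightarrow> real)) \<Rightarrow> bool" where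
  "norm_continuous_on A T \<longleftrightarrow>
     continuous_map (subtopology (mtopology_of linf_metric) A) (mtopology_of linf_metric) T"

text \<open>Functions on \<open>[0, \<infinity>)\<close> are total functions on the reals of which only the values on \<open>{0..}\<close> matter.\<close>

definition class_K :: "(real \<Rightarrow> real) set" where
  "class_K = {\<gamma>. \<gamma> \<in> {0..} \<rightarrow> {0..} \<and> continuous_on {0..} \<gamma> \<and> strict_mono_on {0..} \<gamma> \<and> \<gamma> 0 = 0}"

definition zero_gain :: "(real \<Rightarrow> real) set" where
  "zero_gain = {\<gamma>. \<forall>r\<ge>0. \<gamma> r = 0}"

text \<open>Only the values of \<open>\<mu>\<close> on \<open>linf_pos\<close> matter.\<close>

definition MAF :: "((nat \<Rightarrow> real) \<Rightarrow> ennreal) \<Rightarrow> bool" where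
  "MAF \<mu> \<longleftrightarrow>
     \<mu> (\<lambda>_. 0) = 0 \<and>
     mono_on linf_pos \<mu> \<and>
     (\<forall>I. finite I \<longrightarrow>
        (\<forall>s\<in>linf_pos_on I. \<mu> s < \<infinity>) \<and>
        continuous_map (subtopology (mtopology_of linf_metric) (linf_pos_on I)) euclidean \<mu>)"

definition gain_data ::
  "(nat \<Rightarrow> nat set) \<Rightarrow> (nat \<Rightarrow> nat \<Rightarrow> real \<Rightarrow> real) \<Rightarrow> (nat \<Rightarrow> (nat \<Rightarrow> real) \<Rightarrow> ennreal) \<Rightarrow> bool" where
  "gain_data I \<gamma> \<mu> \<longleftrightarrow>
     (\<forall>i. finite (I i) \<and> i \<notin> I i \<and>
          (\<forall>j. \<gamma> i j \<in> class_K \<union> zero_gain) \<and>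
          (\<forall>j. j \<notin> I i \<longrightarrow> \<gamma> i j \<in> zero_gain) \<and>
          MAF (\<mu> i))"

text \<open>
  The formula defining a gain operator yields sequences in \<open>[0, \<infinity>]\<close>. The operator is well-defined if each
  of these is (the image under \<^const>\<open>ennreal\<close> of) an element of \<open>linf_pos\<close>; \<open>\<Gamma>\<close> is the operator
  returning that element, which is unique.
\<close>

definition well_defined_gain_operator ::
  "(nat \<Rightarrow> nat set) \<Rightarrow> (nat \<Rightarrow> nat \<Rightarrow> real \<Rightarrow> real) \<Rightarrow> (nat \<Rightarrow> (nat \<Rightarrow> real) \<Rightarrow> ennreal)
    \<Rightarrow> ((nat \<Rightarrow> real) \<Rightarrow> (nat \<Rightarrow> real)) \<Rightarrow> bool" where
  "well_defined_gain_operator I \<gamma> \<mu> \<Gamma> \<longleftrightarrow>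
     gain_data I \<gamma> \<mu> \<and>
     \<Gamma> \<in> linf_pos \<rightarrow> linf_pos \<and>
     (\<forall>s\<in>linf_pos. \<forall>i. ennreal (\<Gamma> s i) = \<mu> i (\<lambda>j. \<gamma> i j (s j)))"

definition augmented :: "((nat \<Rightarrow> real) \<Rightarrow> (nat \<Rightarrow> real)) \<Rightarrow> (nat \<Rightarrow> real) \<Rightarrow> (nat \<Rightarrow> real)" where
  "augmented \<Gamma> s = sup s (\<Gamma> s)"

definition point_of_decay :: "((nat \<Rightarrow> real) \<Rightarrow> (nat \<Rightarrow> real)) \<Rightarrow> (nat \<Rightarrow> real) \<Rightarrow> bool" where
  "point_of_decay \<Gamma> s \<longleftrightarrow> s \<in> linf_pos \<and> s \<noteq> (\<lambda>_. 0) \<and> \<Gamma> s \<le> s"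

end

theory Submission
  imports Defs
begin

text \<open>
  The componentwise maximum is 1-Lipschitz in the sup norm, so \<open>s \<oplus> \<Gamma>(s)\<close> inherits continuity from \<open>\<Gamma>\<close>.
  Monotonicity of \<open>\<Gamma>\<close> comes from that of the \<open>\<mu>\<^sub>i\<close> and \<open>\<gamma>\<^sub>i\<^sub>j\<close>, the finiteness of \<open>I\<^sub>i\<close> guaranteeing that the
  argument of \<open>\<mu>\<^sub>i\<close> is bounded. The iterates of the augmented operator increase in \<open>n\<close>, so in
  \<open>s \<oplus> \<Gamma>(s\<^sub>n\<^sub>-\<^sub>1) \<oplus> \<Gamma>(s\<^sub>n)\<close> the middle term is absorbed by the last one.
\<close>

section \<open>The sup metric, componentwise maxima and continuity\<close>

lemma mdist_linf_metric_le_iff: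
  assumes "s \<in> mspace linf_metric" "t \<in> mspace linf_metric"
  shows "mdist linf_metric s t \<le> c \<longleftrightarrow> (\<forall>i. \<bar>s i - t i\<bar> \<le> c)"
proof -
  have bdd: "bounded (range s)" "bounded (range t)"
    using assms by (auto simp: mspace_linf_metric)
  \<comment> \<open>A supremum of reals is controlled by \<open>cSUP_le_iff\<close> only if the
    family is bounded above; the sum of the two bounds provides this.\<close>
  obtain a b where "\<And>i. \<bar>s i\<bar> \<le> a" "\<And>i. \<bar>t i\<bar> \<le> b"
    using bdd by (auto simp: bounded_iff)
  then have "\<bar>s i - t i\<bar> \<le> a + b" for i
    by (rule order_trans[OF abs_triangle_ineq4 add_mono])
  then have "bdd_above (range (\<lambda>i. \<bar>s i - t i\<bar>))"
    by (intro bdd_aboveI[where M = "a + b"]) auto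
  then show ?thesis
    using bdd by (auto simp: mdist_linf_metric cSUP_le_iff)
qed

lemma sup_in_mspace_linf_metric:
  assumes "s \<in> mspace linf_metric" "t \<in> mspace linf_metric"
  shows "sup s t \<in> mspace linf_metric"
proof -
  obtain a b where "\<And>i. \<bar>s i\<bar> \<le> a" "\<And>i. \<bar>t i\<bar> \<le> b"
    using assms by (auto simp: mspace_linf_metric bounded_iff)
  then have "\<bar>sup s t i\<bar> \<le> max a b" for i
    by (simp add: sup_max) (smt (verit))
  then show ?thesis
    by (auto simp: mspace_linf_metric bounded_iff simp del: sup_apply)
qed

text \<open>In each coordinate \<open>\<bar>max a b - max a' b'\<bar>\<close> is at most
  \<open>max \<bar>a - a'\<bar> \<bar>b - b'\<bar>\<close>, and this bound is uniform in the
  coordinate.\<close>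

lemma mdist_linf_metric_sup_le:
  assumes "s \<in> mspace linf_metric" "t \<in> mspace linf_metric"
    and "s' \<in> mspace linf_metric" "t' \<in> mspace linf_metric"
  shows "mdist linf_metric (sup s t) (sup s' t')
           \<le> max (mdist linf_metric s s') (mdist linf_metric t t')"
proof -
  have "\<bar>s i - s' i\<bar> \<le> mdist linf_metric s s'" "\<bar>t i - t' i\<bar> \<le> mdist linf_metric t t'" for i
    using assms mdist_linf_metric_le_iff by blast+
  then have "\<bar>sup s t i - sup s' t' i\<bar>
      \<le> max (mdist linf_metric s s') (mdist linf_metric t t')" for i
    by (simp add: sup_max) (smt (verit))
  then show ?thesis
    using assms by (simp add: mdist_linf_metric_le_iff sup_in_mspace_linf_metric del: sup_apply)
qed

text \<open>The subspace topology on \<open>A\<close> is the topology of the metric restricted to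
  \<open>A\<close>, so the epsilon-delta criterion for metric spaces applies.\<close>

lemma norm_continuous_on_iff:
  assumes "A \<subseteq> mspace linf_metric"
  shows "norm_continuous_on A T \<longleftrightarrow> T \<in> A \<rightarrow> mspace linf_metric \<and>
    (\<forall>s\<in>A. \<forall>\<epsilon>>0. \<exists>\<delta>>0. \<forall>t\<in>A.
       mdist linf_metric s t < \<delta> \<longrightarrow> mdist linf_metric (T s) (T t) < \<epsilon>)"
proof -
  \<comment> \<open>The restricted metric has carrier \<open>A \<inter> mspace linf_metric\<close>;
    identifying it with \<open>A\<close> lets all quantifiers range over \<open>A\<close>.\<close>
  have "A \<inter> mspace linf_metric = A"
    using assms by blast
  then have "norm_continuous_on A T \<longleftrightarrow> T ` A \<subseteq> mspace linf_metric \<and>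
    (\<forall>s\<in>A. \<forall>\<epsilon>>0. \<exists>\<delta>>0. \<forall>t. t \<in> A \<and> mdist linf_metric s t < \<delta> \<longrightarrow>
       mdist linf_metric (T s) (T t) < \<epsilon>)"
    unfolding norm_continuous_on_def mtopology_of_submetric[symmetric]
    unfolding mtopology_of_def
      Metric_space.metric_continuous_map[OF Metric_space_mspace_mdist Metric_space_mspace_mdist]
    by simp
  also have "\<dots> \<longleftrightarrow> T \<in> A \<rightarrow> mspace linf_metric \<and>
    (\<forall>s\<in>A. \<forall>\<epsilon>>0. \<exists>\<delta>>0. \<forall>t\<in>A.
       mdist linf_metric s t < \<delta> \<longrightarrow> mdist linf_metric (T s) (T t) < \<epsilon>)"
    unfolding image_subset_iff_funcset by meson
  finally show ?thesis .
qed

lemma norm_continuous_on_id: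
  assumes "A \<subseteq> mspace linf_metric"
  shows "norm_continuous_on A (\<lambda>s. s)"
  using assms by (auto simp: norm_continuous_on_iff)

lemma norm_continuous_on_sup:
  assumes A: "A \<subseteq> mspace linf_metric"
    and S: "norm_continuous_on A S" and T: "norm_continuous_on A T"
  shows "norm_continuous_on A (\<lambda>s. sup (S s) (T s))"
  unfolding norm_continuous_on_iff[OF A]
proof (intro conjI ballI allI impI)
  have mem: "S s \<in> mspace linf_metric" "T s \<in> mspace linf_metric" if "s \<in> A" for s
    using S T that by (auto simp: norm_continuous_on_iff[OF A])
  then show "(\<lambda>s. sup (S s) (T s)) \<in> A \<rightarrow> mspace linf_metric"
    by (auto intro: sup_in_mspace_linf_metric)
  fix s and \<epsilon> :: real
  assume s: "s \<in> A" and "0 < \<epsilon>"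
  obtain \<delta>1 where \<delta>1: "\<delta>1 > 0"
      "\<And>t. t \<in> A \<Longrightarrow> mdist linf_metric s t < \<delta>1 \<Longrightarrow> mdist linf_metric (S s) (S t) < \<epsilon>"
    using S s \<open>0 < \<epsilon>\<close> unfolding norm_continuous_on_iff[OF A] by meson
  obtain \<delta>2 where \<delta>2: "\<delta>2 > 0"
      "\<And>t. t \<in> A \<Longrightarrow> mdist linf_metric s t < \<delta>2 \<Longrightarrow> mdist linf_metric (T s) (T t) < \<epsilon>"
    using T s \<open>0 < \<epsilon>\<close> unfolding norm_continuous_on_iff[OF A] by meson
  show "\<exists>\<delta>>0. \<forall>t\<in>A. mdist linf_metric s t < \<delta> \<longrightarrow>
          mdist linf_metric (sup (S s) (T s)) (sup (S t) (T t)) < \<epsilon>"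
  \<comment> \<open>The distance of the suprema is bounded by a maximum rather than a sum, so
    \<open>\<epsilon>\<close> need not be halved.\<close>
  proof (intro exI[of _ "min \<delta>1 \<delta>2"] conjI ballI impI)
    fix t
    assume t: "t \<in> A" and close: "mdist linf_metric s t < min \<delta>1 \<delta>2"
    have "mdist linf_metric (sup (S s) (T s)) (sup (S t) (T t))
        \<le> max (mdist linf_metric (S s) (S t)) (mdist linf_metric (T s) (T t))"
      using mem s t by (intro mdist_linf_metric_sup_le)
    also have "\<dots> < \<epsilon>"
      using \<delta>1(2) \<delta>2(2) t close by simp
    finally show "mdist linf_metric (sup (S s) (T s)) (sup (S t) (T t)) < \<epsilon>" .
  qed (use \<delta>1 \<delta>2 in simp)
qed

section \<open>The cone of nonnegative bounded sequences\<close>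

lemma linf_pos_subset: "linf_pos \<subseteq> mspace linf_metric"
  by (auto simp: linf_pos_def)

lemma sup_in_linf_pos:
  assumes "s \<in> linf_pos" "t \<in> linf_pos"
  shows "sup s t \<in> linf_pos"
  using assms sup_in_mspace_linf_metric[of s t] by (simp add: linf_pos_def le_supI1)

lemma zero_in_linf_pos: "(\<lambda>_. 0) \<in> linf_pos"
  by (simp add: linf_pos_def mspace_linf_metric)

text \<open>A sequence with finite support takes only finitely many values, hence is
  bounded.\<close>

lemma finite_support_in_linf_pos:
  assumes "finite J" "\<And>j. j \<notin> J \<Longrightarrow> s j = 0" "\<And>j. 0 \<le> s j"
  shows "s \<in> linf_pos"
proof -
  have "range s \<subseteq> insert 0 (s ` J)"
    using assms(2) by blast
  then have "finite (range s)"
    using assms(1) finite_subset by blast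
  then show ?thesis
    using assms(3) by (simp add: linf_pos_def mspace_linf_metric finite_imp_bounded)
qed

section \<open>Gain functions, monotonicity of the gain operator and its value at zero\<close>

lemma class_K_zero_gain_mono:
  assumes "\<gamma> \<in> class_K \<union> zero_gain" "0 \<le> r" "r \<le> r'"
  shows "\<gamma> r \<le> \<gamma> r'"
proof (cases "\<gamma> \<in> zero_gain")
  case True
  then show ?thesis
    using assms by (simp add: zero_gain_def)
next
  case False
  then have "mono_on {0..} \<gamma>"
    using assms(1) by (simp add: class_K_def strict_mono_on_imp_mono_on)
  then show ?thesis
    using mono_onD[of "{0..}" \<gamma> r r'] assms(2,3) by simp
qed

lemma class_K_zero_gain_nonneg:
  assumes "\<gamma> \<in> class_K \<union> zero_gain" "0 \<le> r"
  shows "0 \<le> \<gamma> r"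
proof (cases "\<gamma> \<in> zero_gain")
  case False
  then have "\<gamma> \<in> {0..} \<rightarrow> {0..}"
    using assms(1) by (simp add: class_K_def)
  then show ?thesis
    using funcset_mem[of \<gamma> "{0..}" "{0..}" r] assms(2) by simp
qed (use assms in \<open>simp add: zero_gain_def\<close>)

text \<open>A MAF is known to be monotone only on \<open>linf_pos\<close>, so its arguments must be
  shown to lie there. They do because the gains vanish outside the finite set
  \<open>I i\<close>.\<close>

lemma gain_input_in_linf_pos:
  assumes "gain_data I \<gamma> \<mu>" "s \<in> linf_pos"
  shows "(\<lambda>j. \<gamma> i j (s j)) \<in> linf_pos"
proof (rule finite_support_in_linf_pos)
  have s: "0 \<le> s j" for j
    using assms(2) by (simp add: linf_pos_def)
  show "finite (I i)"
    using assms(1) by (simp add: gain_data_def)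
  show "\<gamma> i j (s j) = 0" if "j \<notin> I i" for j
    using assms(1) s that by (simp add: gain_data_def zero_gain_def)
  show "0 \<le> \<gamma> i j (s j)" for j
  proof -
    have "\<gamma> i j \<in> class_K \<union> zero_gain"
      using assms(1) unfolding gain_data_def by blast
    then show ?thesis
      using s by (rule class_K_zero_gain_nonneg)
  qed
qed

lemma gain_operator_mono:
  assumes "well_defined_gain_operator I \<gamma> \<mu> \<Gamma>"
  shows "mono_on linf_pos \<Gamma>"
proof (intro mono_onI le_funI)
  fix s t i
  assume s: "s \<in> linf_pos" and t: "t \<in> linf_pos" and "s \<le> t"
  have gd: "gain_data I \<gamma> \<mu>"
    using assms by (simp add: well_defined_gain_operator_def)
  have "\<gamma> i j (s j) \<le> \<gamma> i j (t j)" for j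
  proof -
    have "\<gamma> i j \<in> class_K \<union> zero_gain"
      using gd unfolding gain_data_def by blast
    moreover have "0 \<le> s j" "s j \<le> t j"
      using s \<open>s \<le> t\<close> by (auto simp: linf_pos_def le_fun_def)
    ultimately show ?thesis
      by (rule class_K_zero_gain_mono)
  qed
  then have "(\<lambda>j. \<gamma> i j (s j)) \<le> (\<lambda>j. \<gamma> i j (t j))"
    by (simp add: le_fun_def)
  moreover have "mono_on linf_pos (\<mu> i)"
    using gd by (simp add: gain_data_def MAF_def)
  ultimately have "\<mu> i (\<lambda>j. \<gamma> i j (s j)) \<le> \<mu> i (\<lambda>j. \<gamma> i j (t j))"
    using gain_input_in_linf_pos[OF gd s] gain_input_in_linf_pos[OF gd t] by (simp add: mono_onD)
  then have "ennreal (\<Gamma> s i) \<le> ennreal (\<Gamma> t i)"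
    using assms s t by (simp add: well_defined_gain_operator_def)
  \<comment> \<open>Since \<open>ennreal\<close> sends negative reals to 0, the inequality returns
    to the reals by way of the sign of the right-hand side.\<close>
  moreover have "0 \<le> \<Gamma> t i"
    using assms t by (auto simp: well_defined_gain_operator_def linf_pos_def)
  ultimately show "\<Gamma> s i \<le> \<Gamma> t i"
    by simp
qed

text \<open>Functions in \<open>class_K\<close> and in \<open>zero_gain\<close> both vanish at 0, so
  each \<open>\<mu> i\<close> is evaluated at the zero sequence.\<close>

lemma gain_operator_zero:
  assumes "well_defined_gain_operator I \<gamma> \<mu> \<Gamma>"
  shows "\<Gamma> (\<lambda>_. 0) = (\<lambda>_. 0)"
proof
  fix i
  have gd: "gain_data I \<gamma> \<mu>"
    using assms by (simp add: well_defined_gain_operator_def)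
  have "\<gamma> i j 0 = 0" for j
    using gd by (auto simp: gain_data_def class_K_def zero_gain_def)
  then have "ennreal (\<Gamma> (\<lambda>_. 0) i) = 0"
    using assms gd zero_in_linf_pos
    by (simp add: well_defined_gain_operator_def gain_data_def MAF_def)
  \<comment> \<open>The equation in \<open>ennreal\<close> says only that the real value is at most
    0.\<close>
  moreover have "0 \<le> \<Gamma> (\<lambda>_. 0) i"
    using assms zero_in_linf_pos by (auto simp: well_defined_gain_operator_def linf_pos_def)
  ultimately show "\<Gamma> (\<lambda>_. 0) i = 0"
    by simp
qed

section \<open>Iterates of the augmented operator\<close>

lemma funpow_in_linf_pos:
  assumes "T \<in> linf_pos \<rightarrow> linf_pos" "s \<in> linf_pos"
  shows "(T ^^ n) s \<in> linf_pos"
proof (induction n)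
  case (Suc n)
  then show ?case
    using funcset_mem[OF assms(1)] by simp
qed (simp add: assms(2))

lemma augmented_in_linf_pos:
  assumes "T \<in> linf_pos \<rightarrow> linf_pos"
  shows "augmented T \<in> linf_pos \<rightarrow> linf_pos"
  unfolding augmented_def by (intro Pi_I sup_in_linf_pos funcset_mem[OF assms])

lemma le_augmented: "s \<le> augmented T s" "T s \<le> augmented T s"
  by (simp_all add: augmented_def)

lemma augmented_mono:
  assumes "mono_on linf_pos T"
  shows "mono_on linf_pos (augmented T)"
proof (rule mono_onI)
  fix s t
  assume "s \<in> linf_pos" "t \<in> linf_pos" "s \<le> t"
  then show "augmented T s \<le> augmented T t"
    unfolding augmented_def by (metis sup_mono mono_onD[OF assms])
qed

text \<open>Each further application can only enlarge the sequence, so the iterates form an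
  increasing chain.\<close>

lemma augmented_funpow_mono:
  assumes "m \<le> n"
  shows "(augmented T ^^ m) s \<le> (augmented T ^^ n) s"
proof (rule lift_Suc_mono_le[OF _ assms])
  show "(augmented T ^^ n) s \<le> (augmented T ^^ Suc n) s" for n
    by (simp add: le_augmented(1))
qed

text \<open>By induction: monotonicity of \<open>T\<close> transports the bound through one
  application, and \<open>T\<close> lies below \<open>augmented T\<close>. Both iterates stay in
  \<open>linf_pos\<close>, where \<open>T\<close> is monotone.\<close>

lemma augmented_funpow_ge:
  assumes T: "T \<in> linf_pos \<rightarrow> linf_pos" "mono_on linf_pos T" and s: "s \<in> linf_pos"
  shows "(T ^^ n) s \<le> (augmented T ^^ n) s"
proof (induction n)
  case (Suc n)
  have "T ((T ^^ n) s) \<le> T ((augmented T ^^ n) s)"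
    using funpow_in_linf_pos[OF T(1) s] funpow_in_linf_pos[OF augmented_in_linf_pos[OF T(1)] s] Suc
    by (rule mono_onD[OF T(2)])
  also have "\<dots> \<le> augmented T ((augmented T ^^ n) s)"
    by (rule le_augmented)
  finally show ?case
    by simp
qed simp

lemma augmented_funpow_Suc:
  assumes T: "T \<in> linf_pos \<rightarrow> linf_pos" "mono_on linf_pos T" and s: "s \<in> linf_pos"
  shows "(augmented T ^^ Suc n) s = sup s (T ((augmented T ^^ n) s))"
proof (induction n)
  case 0
  show ?case
    by (simp add: augmented_def)
next
  case (Suc n)
  have "T ((augmented T ^^ n) s) \<le> T ((augmented T ^^ Suc n) s)"
    by (rule mono_onD[OF T(2)])
       (simp_all only: funpow_in_linf_pos[OF augmented_in_linf_pos[OF T(1)] s]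
          augmented_funpow_mono le_SucI order_refl)
  then have "sup (sup s (T ((augmented T ^^ n) s))) (T ((augmented T ^^ Suc n) s))
      = sup s (T ((augmented T ^^ Suc n) s))"
    by (simp add: sup.absorb2 sup_assoc)
  moreover have "(augmented T ^^ Suc (Suc n)) s
      = sup ((augmented T ^^ Suc n) s) (T ((augmented T ^^ Suc n) s))"
    by (simp add: augmented_def)
  ultimately show ?case
    \<comment> \<open>The induction hypothesis rewrites the left argument of the outer
      \<open>sup\<close>, which produces the three-term supremum simplified above.\<close>
    by (metis Suc)
qed

theorem proposition3p1:
  fixes I :: "nat \<Rightarrow> nat set"
    and \<gamma> :: "nat \<Rightarrow> nat \<Rightarrow> real \<Rightarrow> real"
    and \<mu> :: "nat \<Rightarrow> (nat \<Rightarrow> real) \<Rightarrow> ennreal"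
    and \<Gamma> :: "(nat \<Rightarrow> real) \<Rightarrow> (nat \<Rightarrow> real)"
  assumes "well_defined_gain_operator I \<gamma> \<mu> \<Gamma>"
    and "norm_continuous_on linf_pos \<Gamma>"
  shows
    "(augmented \<Gamma> \<in> linf_pos \<rightarrow> linf_pos \<and> norm_continuous_on linf_pos (augmented \<Gamma>)) \<and>
     (augmented \<Gamma> (\<lambda>_. 0) = (\<lambda>_. 0) \<and> mono_on linf_pos (augmented \<Gamma>)) \<and>
     (\<forall>s\<in>linf_pos. s \<le> augmented \<Gamma> s) \<and>
     ((\<forall>s\<in>linf_pos. augmented \<Gamma> s = s \<longleftrightarrow> \<Gamma> s \<le> s) \<and>
       {s \<in> linf_pos. s \<noteq> (\<lambda>_. 0) \<and> augmented \<Gamma> s = s} = {s. point_of_decay \<Gamma> s}) \<and>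
     (\<forall>n\<ge>0. \<forall>s\<in>linf_pos. (\<lambda>k. MAX i\<in>{0..n}. (\<Gamma> ^^ i) s k) \<le> (augmented \<Gamma> ^^ n) s) \<and>
     (\<forall>n\<ge>1. \<forall>s\<in>linf_pos. (augmented \<Gamma> ^^ n) s = sup s (\<Gamma> ((augmented \<Gamma> ^^ (n - 1)) s)))"
proof -
  have T: "\<Gamma> \<in> linf_pos \<rightarrow> linf_pos"
    using assms(1) by (simp add: well_defined_gain_operator_def)
  note mono = gain_operator_mono[OF assms(1)]
  \<comment> \<open>The augmented operator is the supremum of two continuous maps, the identity and
    \<open>\<Gamma>\<close>.\<close>
  have cont: "norm_continuous_on linf_pos (augmented \<Gamma>)"
    using norm_continuous_on_sup[OF linf_pos_subset norm_continuous_on_id[OF linf_pos_subset] assms(2)]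
    by (simp add: augmented_def[abs_def])
  have zero: "augmented \<Gamma> (\<lambda>_. 0) = (\<lambda>_. 0)"
    by (simp add: augmented_def gain_operator_zero[OF assms(1)])
  \<comment> \<open>In a lattice, \<open>sup x y = x\<close> is equivalent to
    \<open>y \<le> x\<close>.\<close>
  have fixed: "augmented \<Gamma> s = s \<longleftrightarrow> \<Gamma> s \<le> s" for s
    by (simp add: augmented_def sup.absorb_iff1)
  have decay: "{s \<in> linf_pos. s \<noteq> (\<lambda>_. 0) \<and> augmented \<Gamma> s = s} = {s. point_of_decay \<Gamma> s}"
    by (simp add: fixed point_of_decay_def)
  have max: "(\<lambda>k. MAX i\<in>{0..n}. (\<Gamma> ^^ i) s k) \<le> (augmented \<Gamma> ^^ n) s"
    if s: "s \<in> linf_pos" for n s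
  proof (rule le_funI)
    fix k
    \<comment> \<open>Pass first from \<open>\<Gamma>\<close> to \<open>augmented \<Gamma>\<close>
      at the same exponent \<open>i\<close>, then raise the exponent to \<open>n\<close>.\<close>
    have "(\<Gamma> ^^ i) s \<le> (augmented \<Gamma> ^^ n) s" if "i \<le> n" for i
      using augmented_funpow_ge[OF T mono s] augmented_funpow_mono[OF that] by (rule order_trans)
    then show "(MAX i\<in>{0..n}. (\<Gamma> ^^ i) s k) \<le> (augmented \<Gamma> ^^ n) s k"
      by (simp add: le_fun_def)
  qed
  have step: "(augmented \<Gamma> ^^ n) s = sup s (\<Gamma> ((augmented \<Gamma> ^^ (n - 1)) s))"
    if "1 \<le> n" "s \<in> linf_pos" for n s
    \<comment> \<open>With \<open>1 \<le> n\<close>, truncated subtraction is harmless: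
      \<open>Suc (n - 1)\<close> equals \<open>n\<close>.\<close>
    using augmented_funpow_Suc[OF T mono that(2), of "n - 1"] that(1) by simp
  show ?thesis
    by (intro conjI ballI allI impI;
        (rule augmented_in_linf_pos[OF T] cont zero augmented_mono[OF mono] le_augmented(1)
          fixed decay max step; assumption?))
qed

end
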